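(* Let $\mathcal C$ be a balanced factorization category, $X$ an object of $\mathcal C$ and $x,y,z:1\to X$ points. The enriched composition map $\mu_{x,y,z}:X(x,y)\times X(y,z)\to X(x,z)$ induces on elements the composition mapping $\overline X(x,y)\times\overline X(y,z)\to\overline X(x,z)$ of the underlying category $\overline X$. That is, for all $\alpha:1\to X(x,y)$ and $\beta:1\to X(y,z)$, the left arrow $x\to z$ corresponding to $\mu_{x,y,z}\circ\langle\alpha,\beta\rangle:1\to X(x,z)$ is the composite in $\overline X$ of the left arrows $x\to y$ and $y\to z$ corresponding to $\alpha$ and $\beta$.
   Context: A balanced factorization category is a finitely complete category $\mathcal C$ with two (orthogonal) factorization systems $(\mathcal E,\mathcal M)$ and $(\mathcal E',\mathcal M')$ such that $\mathcal M/1=\mathcal M'/1$ (an object $S$ has $S\to 1$ in $\mathcal M$ iff in $\mathcal M'$), and such that the pullback of a map in $\mathcal E$ along a map in $\mathcal M'$ is in $\mathcal E$, and the pullback of a map in $\mathcal E'$ along a map in $\mathcal M$ is in $\mathcal E'$. Maps in $\mathcal E,\mathcal M,\mathcal E',\mathcal M'$ are called final, discrete fibrations, initial, discrete opfibrations respectively; factorizations are chosen. Internal sets are the objects $S$ with $S\to1$ in $\mathcal M$ (equivalently $\mathcal M'$); they form a reflective full subcategory $\mathcal S$ with reflection $\pi_0:\mathcal C\to\mathcal S$. A point $x:1\to X$ factors as $1\xrightarrow{e_x}X/x\xrightarrow{\downarrow x}X$ with $e_x\in\mathcal E$, $\downarrow x\in\mathcal M$ (slice), and as $1\xrightarrow{i_x}x\backslash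 X\xrightarrow{\uparrow x}X$ with $i_x\in\mathcal E'$, $\uparrow x\in\mathcal M'$ (coslice). A left arrow $\alpha:x\to y$ is a map $\alpha:1\to X/y$ with $(\downarrow y)\alpha=x$; it corresponds to the unique $\widehat\alpha:X/x\to X/y$ over $X$ with $\widehat\alpha e_x=\alpha$. The underlying category $\overline X$ has points of $X$ as objects, left arrows as morphisms, identities $e_x$ and composition $\beta\circ\alpha:=\widehat\beta\circ\alpha$. $[x,y]$ is the pullback of $\uparrow x:x\backslash X\to X$ and $\downarrow y:X/y\to X$, with projections $p_{x,y}:[x,y]\to x\backslash X$ and $q_{x,y}:[x,y]\to X/y$; $X(x,y):=\pi_0[x,y]$ with reflection map $c_{x,y}:[x,y]\to X(x,y)$. Let $i:S\to[x,y]$ be the pullback of $i_x$ along $p_{x,y}$ and $e:S'\to[x,y]$ the pullback of $e_y$ along $q_{x,y}$; then $c_{x,y}i$ and $c_{x,y}e$ are isomorphisms, and one sets $i_{x,y}:=i(c_{x,y}i)^{-1}$, $e_{x,y}:=e(c_{x,y}e)^{-1}$, both maps $X(x,y)\to[x,y]$. An element $\alpha:1\to X(x,y)$ corresponds to the left arrow $q_{x,y}\circ i_{x,y}\circ\alpha:x\to y$; this is a bijection $\mathcal C(1,X(x,y))\cong\overline X(x,y)$. Enriched composition: $\mu_{x,y,z}:=c_{x,z}\circ\mu'$, where $\mu':X(x,y)\times X(y,z)\to[x,z]$ is the map into the pullback $[x,z]$ with components $p_{x,y}\circ e_{x,y}\circ\mathrm{pr}_1$ (to $x\backslash X$) and $q_{y,z}\circ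 i_{y,z}\circ\mathrm{pr}_2$ (to $X/z$). *)

theory Defs
  imports Main
begin

section \<open>Categories\<close>

record ('o, 'm) cat =
  Obj :: "'o set"
  Arr :: "'m set"
  Dom :: "'m \<Rightarrow> 'o"
  Cod :: "'m \<Rightarrow> 'o"
  Idt :: "'o \<Rightarrow> 'm"
  Cmp :: "'m \<Rightarrow> 'm \<Rightarrow> 'm" (infixr "\<cdot>\<index>" 70)

definition hom :: "('o, 'm, 'r) cat_scheme \<Rightarrow> 'o \<Rightarrow> 'o \<Rightarrow> 'm set" where
  "hom C a b = {f \<in> Arr C. Dom C f = a \<and> Cod C f = b}"

locale category =
  fixes C :: "('o, 'm, 'r) cat_scheme" (structure)
  assumes dom_obj: "f \<in> Arr C \<Longrightarrow> Dom C f \<in> Obj C"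
    and cod_obj: "f \<in> Arr C \<Longrightarrow> Cod C f \<in> Obj C"
    and idt_hom: "a \<in> Obj C \<Longrightarrow> Idt C a \<in> hom C a a"
    and cmp_hom: "f \<in> hom C a b \<Longrightarrow> g \<in> hom C b c \<Longrightarrow> g \<cdot> f \<in> hom C a c"
    and idt_left: "f \<in> hom C a b \<Longrightarrow> Idt C b \<cdot> f = f"
    and idt_right: "f \<in> hom C a b \<Longrightarrow> f \<cdot> Idt C a = f"
    and cmp_assoc: "f \<in> hom C a b \<Longrightarrow> g \<in> hom C b c \<Longrightarrow> h \<in> hom C c d \<Longrightarrow>
      (h \<cdot> g) \<cdot> f = h \<cdot> (g \<cdot> f)"

definition inverse_of :: "('o, 'm, 'r) cat_scheme \<Rightarrow> 'm \<Rightarrow> 'm" where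
  "inverse_of C f = (THE g. g \<in> hom C (Cod C f) (Dom C f) \<and>
     g \<cdot>\<^bsub>C\<^esub> f = Idt C (Dom C f) \<and> f \<cdot>\<^bsub>C\<^esub> g = Idt C (Cod C f))"

section \<open>Limits\<close>

definition is_functor ::
  "('i, 'a, 's) cat_scheme \<Rightarrow> ('o, 'm, 'r) cat_scheme \<Rightarrow> ('i \<Rightarrow> 'o) \<Rightarrow> ('a \<Rightarrow> 'm) \<Rightarrow> bool" where
  "is_functor J C F0 F1 \<longleftrightarrow>
     (\<forall>j \<in> Obj J. F0 j \<in> Obj C \<and> F1 (Idt J j) = Idt C (F0 j)) \<and>
     (\<forall>u \<in> Arr J. F1 u \<in> hom C (F0 (Dom J u)) (F0 (Cod J u))) \<and>
     (\<forall>u \<in> Arr J. \<forall>v \<in> Arr J. Cod J u = Dom J v \<longrightarrow> F1 (v \<cdot>\<^bsub>J\<^esub> u) = F1 v \<cdot>\<^bsub>C\<^esub> F1 u)"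

definition is_cone ::
  "('i, 'a, 's) cat_scheme \<Rightarrow> ('o, 'm, 'r) cat_scheme \<Rightarrow> ('i \<Rightarrow> 'o) \<Rightarrow> ('a \<Rightarrow> 'm) \<Rightarrow>
   'o \<Rightarrow> ('i \<Rightarrow> 'm) \<Rightarrow> bool" where
  "is_cone J C F0 F1 N \<psi> \<longleftrightarrow> N \<in> Obj C \<and>
     (\<forall>j \<in> Obj J. \<psi> j \<in> hom C N (F0 j)) \<and>
     (\<forall>u \<in> Arr J. F1 u \<cdot>\<^bsub>C\<^esub> \<psi> (Dom J u) = \<psi> (Cod J u))"

definition is_limit ::
  "('i, 'a, 's) cat_scheme \<Rightarrow> ('o, 'm, 'r) cat_scheme \<Rightarrow> ('i \<Rightarrow> 'o) \<Rightarrow> ('a \<Rightarrow> 'm) \<Rightarrow>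
   'o \<Rightarrow> ('i \<Rightarrow> 'm) \<Rightarrow> bool" where
  "is_limit J C F0 F1 L \<pi> \<longleftrightarrow> is_cone J C F0 F1 L \<pi> \<and>
     (\<forall>N \<psi>. is_cone J C F0 F1 N \<psi> \<longrightarrow>
        (\<exists>!h. h \<in> hom C N L \<and> (\<forall>j \<in> Obj J. \<pi> j \<cdot>\<^bsub>C\<^esub> h = \<psi> j)))"

text \<open>Every finite category is isomorphic to one whose objects and arrows are natural numbers.\<close>

definition finitely_complete :: "('o, 'm, 'r) cat_scheme \<Rightarrow> bool" where
  "finitely_complete C \<longleftrightarrow>
     (\<forall>(J :: (nat, nat) cat) F0 F1.
        category J \<and> finite (Obj J) \<and> finite (Arr J) \<and> is_functor J C F0 F1 \<longrightarrow>
        (\<exists>L \<pi>. is_limit J C F0 F1 L \<pi>))"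

definition is_terminal :: "('o, 'm, 'r) cat_scheme \<Rightarrow> 'o \<Rightarrow> bool" where
  "is_terminal C t \<longleftrightarrow> t \<in> Obj C \<and> (\<forall>a \<in> Obj C. \<exists>!f. f \<in> hom C a t)"

definition is_product :: "('o, 'm, 'r) cat_scheme \<Rightarrow> 'o \<Rightarrow> 'o \<Rightarrow> 'o \<Rightarrow> 'm \<Rightarrow> 'm \<Rightarrow> bool" where
  "is_product C a b p r s \<longleftrightarrow> r \<in> hom C p a \<and> s \<in> hom C p b \<and>
     (\<forall>t f g. f \<in> hom C t a \<and> g \<in> hom C t b \<longrightarrow>
        (\<exists>!h. h \<in> hom C t p \<and> r \<cdot>\<^bsub>C\<^esub> h = f \<and> s \<cdot>\<^bsub>C\<^esub> h = g))"

text \<open>In \<open>is_pullback C f g r s\<close> the square is \<open>f \<cdot> r = g \<cdot> s\<close>; thus \<open>s\<close> is the pullback of \<open>f\<close>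
  along \<open>g\<close>, and \<open>r\<close> the pullback of \<open>g\<close> along \<open>f\<close>.\<close>

definition is_pullback :: "('o, 'm, 'r) cat_scheme \<Rightarrow> 'm \<Rightarrow> 'm \<Rightarrow> 'm \<Rightarrow> 'm \<Rightarrow> bool" where
  "is_pullback C f g r s \<longleftrightarrow>
     f \<in> Arr C \<and> g \<in> Arr C \<and> r \<in> Arr C \<and> s \<in> Arr C \<and>
     Cod C f = Cod C g \<and> Dom C r = Dom C s \<and> Cod C r = Dom C f \<and> Cod C s = Dom C g \<and>
     f \<cdot>\<^bsub>C\<^esub> r = g \<cdot>\<^bsub>C\<^esub> s \<and>
     (\<forall>t u v. u \<in> hom C t (Dom C f) \<and> v \<in> hom C t (Dom C g) \<and> f \<cdot>\<^bsub>C\<^esub> u = g \<cdot>\<^bsub>C\<^esub> v \<longrightarrow>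
        (\<exists>!h. h \<in> hom C t (Dom C r) \<and> r \<cdot>\<^bsub>C\<^esub> h = u \<and> s \<cdot>\<^bsub>C\<^esub> h = v))"

section \<open>Balanced factorization categories\<close>

definition orthogonal :: "('o, 'm, 'r) cat_scheme \<Rightarrow> 'm \<Rightarrow> 'm \<Rightarrow> bool" where
  "orthogonal C e m \<longleftrightarrow>
     (\<forall>u v. u \<in> hom C (Dom C e) (Dom C m) \<and> v \<in> hom C (Cod C e) (Cod C m) \<and>
        m \<cdot>\<^bsub>C\<^esub> u = v \<cdot>\<^bsub>C\<^esub> e \<longrightarrow>
        (\<exists>!d. d \<in> hom C (Cod C e) (Dom C m) \<and> d \<cdot>\<^bsub>C\<^esub> e = u \<and> m \<cdot>\<^bsub>C\<^esub> d = v))"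

definition factorization_system :: "('o, 'm, 'r) cat_scheme \<Rightarrow> 'm set \<Rightarrow> 'm set \<Rightarrow> bool" where
  "factorization_system C E M \<longleftrightarrow>
     E = {e \<in> Arr C. \<forall>m \<in> M. orthogonal C e m} \<and>
     M = {m \<in> Arr C. \<forall>e \<in> E. orthogonal C e m} \<and>
     (\<forall>f \<in> Arr C. \<exists>e \<in> E. \<exists>m \<in> M. Cod C e = Dom C m \<and> m \<cdot>\<^bsub>C\<^esub> e = f)"

record ('o, 'm) fact_cat = "('o, 'm) cat" +
  Final :: "'m set"
  Dfib :: "'m set"
  Initial :: "'m set"
  Dopf :: "'m set"

locale balanced_factorization_category = category C
  for C :: "('o, 'm, 'r) fact_cat_scheme" (structure) +
  assumes fin_complete: "finitely_complete C"
    and fact_left: "factorization_system C (Final C) (Dfib C)"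
    and fact_right: "factorization_system C (Initial C) (Dopf C)"
    and balanced: "is_terminal C t \<Longrightarrow> f \<in> hom C S t \<Longrightarrow> f \<in> Dfib C \<longleftrightarrow> f \<in> Dopf C"
    and final_stable:
      "is_pullback C f g r s \<Longrightarrow> f \<in> Final C \<Longrightarrow> g \<in> Dopf C \<Longrightarrow> s \<in> Final C"
    and initial_stable:
      "is_pullback C f g r s \<Longrightarrow> f \<in> Initial C \<Longrightarrow> g \<in> Dfib C \<Longrightarrow> s \<in> Initial C"

text \<open>A choice of the universal constructions: terminal object, products, pullbacks
  (\<open>Pb1 C f g\<close> and \<open>Pb2 C f g\<close> are the projections to the domains of \<open>f\<close> and \<open>g\<close>), both
  factorizations of each map, and the reflection \<open>Eta C a : a \<rightarrow> Pi0 C a\<close> into internal sets.\<close>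

record ('o, 'm) chosen_cat = "('o, 'm) fact_cat" +
  One :: 'o
  Prd :: "'o \<Rightarrow> 'o \<Rightarrow> 'o"
  Pr1 :: "'o \<Rightarrow> 'o \<Rightarrow> 'm"
  Pr2 :: "'o \<Rightarrow> 'o \<Rightarrow> 'm"
  Pb1 :: "'m \<Rightarrow> 'm \<Rightarrow> 'm"
  Pb2 :: "'m \<Rightarrow> 'm \<Rightarrow> 'm"
  FinalPart :: "'m \<Rightarrow> 'm"
  DfibPart :: "'m \<Rightarrow> 'm"
  InitialPart :: "'m \<Rightarrow> 'm"
  DopfPart :: "'m \<Rightarrow> 'm"
  Pi0 :: "'o \<Rightarrow> 'o"
  Eta :: "'o \<Rightarrow> 'm"

definition internal_set :: "('o, 'm, 'r) chosen_cat_scheme \<Rightarrow> 'o \<Rightarrow> bool" where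
  "internal_set C S \<longleftrightarrow> S \<in> Obj C \<and> (\<exists>f \<in> hom C S (One C). f \<in> Dfib C)"

locale chosen_structure =
  fixes C :: "('o, 'm, 'r) chosen_cat_scheme" (structure)
  assumes one: "is_terminal C (One C)"
    and prd: "a \<in> Obj C \<Longrightarrow> b \<in> Obj C \<Longrightarrow> is_product C a b (Prd C a b) (Pr1 C a b) (Pr2 C a b)"
    and pb: "f \<in> Arr C \<Longrightarrow> g \<in> Arr C \<Longrightarrow> Cod C f = Cod C g \<Longrightarrow>
      is_pullback C f g (Pb1 C f g) (Pb2 C f g)"
    and left_part: "f \<in> Arr C \<Longrightarrow> FinalPart C f \<in> Final C \<and> DfibPart C f \<in> Dfib C \<and>
      Cod C (FinalPart C f) = Dom C (DfibPart C f) \<and> DfibPart C f \<cdot> FinalPart C f = f"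
    and right_part: "f \<in> Arr C \<Longrightarrow> InitialPart C f \<in> Initial C \<and> DopfPart C f \<in> Dopf C \<and>
      Cod C (InitialPart C f) = Dom C (DopfPart C f) \<and> DopfPart C f \<cdot> InitialPart C f = f"
    and pi0: "a \<in> Obj C \<Longrightarrow> internal_set C (Pi0 C a) \<and> Eta C a \<in> hom C a (Pi0 C a)"
    and reflection: "a \<in> Obj C \<Longrightarrow> internal_set C S \<Longrightarrow> f \<in> hom C a S \<Longrightarrow>
      \<exists>!g. g \<in> hom C (Pi0 C a) S \<and> g \<cdot> Eta C a = f"

definition pairing :: "('o, 'm, 'r) chosen_cat_scheme \<Rightarrow> 'm \<Rightarrow> 'm \<Rightarrow> 'm" where
  "pairing C f g = (THE h. h \<in> hom C (Dom C f) (Prd C (Cod C f) (Cod C g)) \<and>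
     Pr1 C (Cod C f) (Cod C g) \<cdot>\<^bsub>C\<^esub> h = f \<and> Pr2 C (Cod C f) (Cod C g) \<cdot>\<^bsub>C\<^esub> h = g)"

section \<open>Slices, coslices and the underlying category\<close>

definition slice_point :: "('o, 'm, 'r) chosen_cat_scheme \<Rightarrow> 'm \<Rightarrow> 'm" where
  "slice_point C x = FinalPart C x"

definition slice_map :: "('o, 'm, 'r) chosen_cat_scheme \<Rightarrow> 'm \<Rightarrow> 'm" where
  "slice_map C x = DfibPart C x"

definition slice :: "('o, 'm, 'r) chosen_cat_scheme \<Rightarrow> 'm \<Rightarrow> 'o" where
  "slice C x = Dom C (slice_map C x)"

definition coslice_point :: "('o, 'm, 'r) chosen_cat_scheme \<Rightarrow> 'm \<Rightarrow> 'm" where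
  "coslice_point C x = InitialPart C x"

definition coslice_map :: "('o, 'm, 'r) chosen_cat_scheme \<Rightarrow> 'm \<Rightarrow> 'm" where
  "coslice_map C x = DopfPart C x"

definition left_arrow :: "('o, 'm, 'r) chosen_cat_scheme \<Rightarrow> 'm \<Rightarrow> 'm \<Rightarrow> 'm \<Rightarrow> bool" where
  "left_arrow C x y \<alpha> \<longleftrightarrow> \<alpha> \<in> hom C (One C) (slice C y) \<and> slice_map C y \<cdot>\<^bsub>C\<^esub> \<alpha> = x"

definition hat :: "('o, 'm, 'r) chosen_cat_scheme \<Rightarrow> 'm \<Rightarrow> 'm \<Rightarrow> 'm \<Rightarrow> 'm" where
  "hat C x y \<alpha> = (THE h. h \<in> hom C (slice C x) (slice C y) \<and>
     slice_map C y \<cdot>\<^bsub>C\<^esub> h = slice_map C x \<and> h \<cdot>\<^bsub>C\<^esub> slice_point C x = \<alpha>)"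

text \<open>A left arrow \<open>\<alpha> : x \<rightarrow> y\<close> is tagged with its endpoints, as \<open>(x, \<alpha>, y)\<close>.\<close>

definition underlying_category ::
  "('o, 'm, 'r) chosen_cat_scheme \<Rightarrow> 'o \<Rightarrow> ('m, 'm \<times> 'm \<times> 'm) cat" where
  "underlying_category C X =
     \<lparr> Obj = hom C (One C) X,
       Arr = {(x, \<alpha>, y). x \<in> hom C (One C) X \<and> y \<in> hom C (One C) X \<and> left_arrow C x y \<alpha>},
       Dom = (\<lambda>(x, \<alpha>, y). x),
       Cod = (\<lambda>(x, \<alpha>, y). y),
       Idt = (\<lambda>x. (x, slice_point C x, x)),
       Cmp = (\<lambda>(y, \<beta>, z) (x, \<alpha>, y'). (x, hat C y z \<beta> \<cdot>\<^bsub>C\<^esub> \<alpha>, z)) \<rparr>"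

section \<open>Enriched homs\<close>

definition bracket_p :: "('o, 'm, 'r) chosen_cat_scheme \<Rightarrow> 'm \<Rightarrow> 'm \<Rightarrow> 'm" where
  "bracket_p C x y = Pb1 C (coslice_map C x) (slice_map C y)"

definition bracket_q :: "('o, 'm, 'r) chosen_cat_scheme \<Rightarrow> 'm \<Rightarrow> 'm \<Rightarrow> 'm" where
  "bracket_q C x y = Pb2 C (coslice_map C x) (slice_map C y)"

definition bracket :: "('o, 'm, 'r) chosen_cat_scheme \<Rightarrow> 'm \<Rightarrow> 'm \<Rightarrow> 'o" where
  "bracket C x y = Dom C (bracket_p C x y)"

definition ehom :: "('o, 'm, 'r) chosen_cat_scheme \<Rightarrow> 'm \<Rightarrow> 'm \<Rightarrow> 'o" where
  "ehom C x y = Pi0 C (bracket C x y)"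

definition ehom_c :: "('o, 'm, 'r) chosen_cat_scheme \<Rightarrow> 'm \<Rightarrow> 'm \<Rightarrow> 'm" where
  "ehom_c C x y = Eta C (bracket C x y)"

definition ehom_i :: "('o, 'm, 'r) chosen_cat_scheme \<Rightarrow> 'm \<Rightarrow> 'm \<Rightarrow> 'm" where
  "ehom_i C x y = (let i = Pb2 C (coslice_point C x) (bracket_p C x y)
     in i \<cdot>\<^bsub>C\<^esub> inverse_of C (ehom_c C x y \<cdot>\<^bsub>C\<^esub> i))"

definition ehom_e :: "('o, 'm, 'r) chosen_cat_scheme \<Rightarrow> 'm \<Rightarrow> 'm \<Rightarrow> 'm" where
  "ehom_e C x y = (let e = Pb2 C (slice_point C y) (bracket_q C x y)
     in e \<cdot>\<^bsub>C\<^esub> inverse_of C (ehom_c C x y \<cdot>\<^bsub>C\<^esub> e))"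

definition arrow_of :: "('o, 'm, 'r) chosen_cat_scheme \<Rightarrow> 'm \<Rightarrow> 'm \<Rightarrow> 'm \<Rightarrow> 'm \<times> 'm \<times> 'm" where
  "arrow_of C x y \<alpha> = (x, bracket_q C x y \<cdot>\<^bsub>C\<^esub> ehom_i C x y \<cdot>\<^bsub>C\<^esub> \<alpha>, y)"

definition premult :: "('o, 'm, 'r) chosen_cat_scheme \<Rightarrow> 'm \<Rightarrow> 'm \<Rightarrow> 'm \<Rightarrow> 'm" where
  "premult C x y z =
     (THE h. h \<in> hom C (Prd C (ehom C x y) (ehom C y z)) (bracket C x z) \<and>
        bracket_p C x z \<cdot>\<^bsub>C\<^esub> h =
          bracket_p C x y \<cdot>\<^bsub>C\<^esub> ehom_e C x y \<cdot>\<^bsub>C\<^esub> Pr1 C (ehom C x y) (ehom C y z) \<and>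
        bracket_q C x z \<cdot>\<^bsub>C\<^esub> h =
          bracket_q C y z \<cdot>\<^bsub>C\<^esub> ehom_i C y z \<cdot>\<^bsub>C\<^esub> Pr2 C (ehom C x y) (ehom C y z))"

definition mult :: "('o, 'm, 'r) chosen_cat_scheme \<Rightarrow> 'm \<Rightarrow> 'm \<Rightarrow> 'm \<Rightarrow> 'm" where
  "mult C x y z = ehom_c C x z \<cdot>\<^bsub>C\<^esub> premult C x y z"

end

theory Submission
  imports Defs
begin

text \<open>Let \<open>b : y \<rightarrow> z\<close> be the left arrow of \<open>\<beta>\<close>. Since \<open>hat b\<close> lies over \<open>X\<close>, it induces
  \<open>w : [x,y] \<rightarrow> [x,z]\<close> over the coslice of \<open>x\<close>. The points \<open>i \<cdot> \<alpha>\<close> and \<open>e \<cdot> \<alpha>\<close> of \<open>[x,y]\<close> have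
  the same component \<open>\<alpha>\<close>, so by naturality of the reflection \<open>w \<cdot> i \<cdot> \<alpha>\<close> and \<open>w \<cdot> e \<cdot> \<alpha>\<close> have
  the same component. The latter point has projections \<open>p \<cdot> e \<cdot> \<alpha>\<close> and \<open>b\<close>, so its component is
  \<open>\<mu> \<cdot> \<langle>\<alpha>, \<beta>\<rangle>\<close>. The former lies over the coslice point of \<open>x\<close>, hence is the canonical
  representative of its component; its projection to the slice of \<open>z\<close> is \<open>hat b \<cdot> q \<cdot> i \<cdot> \<alpha>\<close>,
  which is the composite of the two left arrows.\<close>

section \<open>Orthogonality, pullbacks and inverses\<close>

lemma homD:
  assumes "f \<in> hom C a b"
  shows "f \<in> Arr C" "Dom C f = a" "Cod C f = b"
  using assms by (auto simp: hom_def)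

lemma ex1_eq: "\<exists>!x. P x \<Longrightarrow> P a \<Longrightarrow> P b \<Longrightarrow> a = b"
  by blast

lemma factorization_systemD:
  assumes fs: "factorization_system C E M"
  shows "e \<in> E \<Longrightarrow> e \<in> Arr C" "m \<in> M \<Longrightarrow> m \<in> Arr C"
    and "e \<in> E \<Longrightarrow> m \<in> M \<Longrightarrow> orthogonal C e m"
proof -
  note E = equalityD1[OF conjunct1[OF fs[unfolded factorization_system_def]], THEN subsetD]
  note M = equalityD1[OF conjunct1[OF conjunct2[OF fs[unfolded factorization_system_def]]],
      THEN subsetD]
  show "e \<in> E \<Longrightarrow> e \<in> Arr C" "e \<in> E \<Longrightarrow> m \<in> M \<Longrightarrow> orthogonal C e m"
    by (drule E, simp)+
  show "m \<in> M \<Longrightarrow> m \<in> Arr C" by (drule M, simp)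
qed

lemma right_classI:
  assumes fs: "factorization_system C E M"
    and m: "\<And>e. e \<in> E \<Longrightarrow> orthogonal C e m" "m \<in> Arr C"
  shows "m \<in> M"
  by (rule equalityD2[OF conjunct1[OF conjunct2[OF fs[unfolded factorization_system_def]]],
        THEN subsetD]) (simp add: m)

text \<open>Stability results concern \<open>s\<close>, the pullback of \<open>f\<close>; swapping
  the legs makes them applicable to \<open>r\<close>, the pullback of \<open>g\<close>.\<close>

lemma is_pullback_sym: "is_pullback C f g r s \<Longrightarrow> is_pullback C g f s r"
  unfolding is_pullback_def by (metis (no_types, lifting))

context category
begin

lemma inverse_of_eq:
  assumes f: "f \<in> hom C a b" and g: "g \<in> hom C b a"
    and gf: "g \<cdot> f = Idt C a" and fg: "f \<cdot> g = Idt C b"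
  shows "inverse_of C f = g"
  unfolding inverse_of_def
proof (rule the_equality)
  fix h
  assume "h \<in> hom C (Cod C f) (Dom C f) \<and> h \<cdot> f = Idt C (Dom C f) \<and> f \<cdot> h = Idt C (Cod C f)"
  then have h: "h \<in> hom C b a" and fh: "f \<cdot> h = Idt C b"
    using homD[OF f] by simp_all
  have "h = (g \<cdot> f) \<cdot> h" using idt_left[OF h] gf by simp
  also have "\<dots> = g \<cdot> (f \<cdot> h)" by (rule cmp_assoc[OF h f g])
  finally show "h = g" using idt_right[OF g] fh by simp
qed (use homD[OF f] g gf fg in simp)

text \<open>A right class consists of the maps with a unique lifting property, and such properties
  pass to pullbacks: a lifting problem against \<open>s\<close> becomes one against \<open>f\<close>
  after composing with \<open>r\<close> and \<open>g\<close>, and the solution \<open>d\<close>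
  together with \<open>v\<close> induces the diagonal into the pullback.\<close>

lemma right_class_stable:
  assumes fs: "factorization_system C E M" and pb: "is_pullback C f g r s" and f: "f \<in> M"
  shows "s \<in> M"
proof -
  have f': "f \<in> hom C (Dom C f) (Cod C f)" and g': "g \<in> hom C (Dom C g) (Cod C f)"
    and r': "r \<in> hom C (Dom C s) (Dom C f)" and s': "s \<in> hom C (Dom C s) (Dom C g)"
    and sq: "f \<cdot> r = g \<cdot> s"
    using pb by (auto simp: is_pullback_def hom_def)
  have univ: "\<exists>!h. h \<in> hom C t (Dom C s) \<and> r \<cdot> h = u \<and> s \<cdot> h = v"
    if "u \<in> hom C t (Dom C f)" "v \<in> hom C t (Dom C g)" "f \<cdot> u = g \<cdot> v" for t u v
    using pb that homD[OF r'] unfolding is_pullback_def by simp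
  have "orthogonal C e s" if e: "e \<in> E" for e
    unfolding orthogonal_def
  proof (intro allI impI, elim conjE)
    fix u v
    assume u: "u \<in> hom C (Dom C e) (Dom C s)" and v: "v \<in> hom C (Cod C e) (Cod C s)"
      and uv: "s \<cdot> u = v \<cdot> e"
    have e': "e \<in> hom C (Dom C e) (Cod C e)"
      using factorization_systemD(1)[OF fs e] by (simp add: hom_def)
    have v': "v \<in> hom C (Cod C e) (Dom C g)" using v homD[OF s'] by simp
    have "orthogonal C e f" by (rule factorization_systemD(3)[OF fs e f])
    moreover have "f \<cdot> (r \<cdot> u) = (g \<cdot> v) \<cdot> e"
      using cmp_assoc[OF u r' f'] cmp_assoc[OF u s' g'] cmp_assoc[OF e' v' g'] sq uv by simp
    ultimately have ex1: "\<exists>!d. d \<in> hom C (Cod C e) (Dom C f) \<and> d \<cdot> e = r \<cdot> u \<and> f \<cdot> d = g \<cdot> v"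
      using cmp_hom[OF u r'] cmp_hom[OF v' g'] unfolding orthogonal_def by simp
    then obtain d where d: "d \<in> hom C (Cod C e) (Dom C f)" "d \<cdot> e = r \<cdot> u" "f \<cdot> d = g \<cdot> v"
      by blast
    obtain h where h: "h \<in> hom C (Cod C e) (Dom C s)" "r \<cdot> h = d" "s \<cdot> h = v"
      using univ[OF d(1) v' d(3)] by blast
    have he': "r \<cdot> (h \<cdot> e) = r \<cdot> u" "s \<cdot> (h \<cdot> e) = s \<cdot> u"
      using cmp_assoc[OF e' h(1) r'] cmp_assoc[OF e' h(1) s'] h(2,3) d(2) uv by metis+
    have "f \<cdot> (r \<cdot> u) = g \<cdot> (s \<cdot> u)"
      using cmp_assoc[OF u r' f'] cmp_assoc[OF u s' g'] sq by metis
    note ex2 = univ[OF cmp_hom[OF u r'] cmp_hom[OF u s'] this]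
    have he: "h \<cdot> e = u"
      by (rule ex1_eq[OF ex2]; intro conjI cmp_hom[OF e' h(1)] he' u refl)
    show "\<exists>!d. d \<in> hom C (Cod C e) (Dom C s) \<and> d \<cdot> e = u \<and> s \<cdot> d = v"
    proof (rule ex1I)
      fix k
      assume k: "k \<in> hom C (Cod C e) (Dom C s) \<and> k \<cdot> e = u \<and> s \<cdot> k = v"
      then have k': "k \<in> hom C (Cod C e) (Dom C s)" by blast
      \<comment> \<open>For any other diagonal \<open>k\<close>, the map \<open>r \<cdot> k\<close>
        solves the problem against \<open>f\<close>; uniqueness there and then in the pullback
        forces \<open>k = h\<close>.\<close>
      have rk: "(r \<cdot> k) \<cdot> e = r \<cdot> u" using cmp_assoc[OF e' k' r'] k by metis
      have frk: "f \<cdot> (r \<cdot> k) = g \<cdot> v"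
        using cmp_assoc[OF k' r' f'] cmp_assoc[OF k' s' g'] sq k by metis
      have "r \<cdot> k = d" by (rule ex1_eq[OF ex1]; intro conjI cmp_hom[OF k' r'] rk frk d)
      then have "k \<in> hom C (Cod C e) (Dom C s) \<and> r \<cdot> k = d \<and> s \<cdot> k = v" using k by blast
      then show "k = h" by (rule ex1_eq[OF univ[OF d(1) v' d(3)]]) (intro conjI h)
    qed (use h he in blast)
  qed
  moreover have "s \<in> Arr C" using homD[OF s'] by simp
  ultimately show ?thesis by (intro right_classI[OF fs])
qed

end

section \<open>Internal sets and their reflection\<close>

locale chosen_balanced_factorization_category =
  balanced_factorization_category C + chosen_structure C
  for C :: "('o, 'm, 'r) chosen_cat_scheme" (structure)
begin

lemma to_one_unique:
  assumes "f \<in> hom C a (One C)" "g \<in> hom C a (One C)"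
  shows "f = g"
proof -
  have "a \<in> Obj C" using assms(1) dom_obj by (auto simp: hom_def)
  then show ?thesis using one assms unfolding is_terminal_def by blast
qed

lemma idt_one_hom: "Idt C (One C) \<in> hom C (One C) (One C)"
  using one idt_hom by (simp add: is_terminal_def)

text \<open>Over the terminal object the square and the lower triangle of a lifting problem commute
  for free, so orthogonality of \<open>e\<close> to \<open>t\<close> becomes unique extension along
  \<open>e\<close>.\<close>

lemma left_class_extends:
  assumes fs: "factorization_system C E M" and e: "e \<in> E" "e \<in> hom C a b"
    and t: "t \<in> M" "t \<in> hom C T (One C)" and u: "u \<in> hom C a T"
  shows "\<exists>!d. d \<in> hom C b T \<and> d \<cdot> e = u"
proof -
  have "b \<in> Obj C" using cod_obj e(2) by (auto simp: hom_def)
  then obtain v where v: "v \<in> hom C b (One C)"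
    using one unfolding is_terminal_def by blast
  have "t \<cdot> u = v \<cdot> e"
    by (rule to_one_unique[OF cmp_hom[OF u t(2)] cmp_hom[OF e(2) v]])
  moreover have "orthogonal C e t" by (rule factorization_systemD(3)[OF fs e(1) t(1)])
  ultimately have "\<exists>!d. d \<in> hom C b T \<and> d \<cdot> e = u \<and> t \<cdot> d = v"
    using u v homD[OF e(2)] homD[OF t(2)] unfolding orthogonal_def by simp
  moreover have "t \<cdot> d = v" if "d \<in> hom C b T" for d
    by (rule to_one_unique[OF cmp_hom[OF that t(2)] v])
  ultimately show ?thesis by metis
qed

lemma final_extends:
  assumes "e \<in> Final C" "e \<in> hom C a b" "internal_set C T" "u \<in> hom C a T"
  shows "\<exists>!d. d \<in> hom C b T \<and> d \<cdot> e = u"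
  using assms left_class_extends[OF fact_left] unfolding internal_set_def by blast

text \<open>Internal sets are defined through \<open>Dfib\<close>; the balance axiom puts their maps
  to \<open>One C\<close> into \<open>Dopf\<close>, the class to which initial maps are
  orthogonal.\<close>

lemma initial_extends:
  assumes "e \<in> Initial C" "e \<in> hom C a b" "internal_set C T" "u \<in> hom C a T"
  shows "\<exists>!d. d \<in> hom C b T \<and> d \<cdot> e = u"
  using assms left_class_extends[OF fact_right] balanced[OF one] unfolding internal_set_def by blast

text \<open>By \<open>ext\<close>, maps from \<open>A\<close> to internal sets correspond to maps
  from \<open>S\<close>. As \<open>S\<close> is itself an internal set, it is another reflection of
  \<open>A\<close>, so the comparison \<open>Eta C A \<cdot> j\<close> is invertible.\<close>

lemma reflection_retract:
  assumes j: "j \<in> hom C S A" and S: "internal_set C S"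
    and ext: "\<And>T u. internal_set C T \<Longrightarrow> u \<in> hom C S T \<Longrightarrow> \<exists>!d. d \<in> hom C A T \<and> d \<cdot> j = u"
  obtains g where "g \<in> hom C (Pi0 C A) S" "g \<cdot> (Eta C A \<cdot> j) = Idt C S"
    "(Eta C A \<cdot> j) \<cdot> g = Idt C (Pi0 C A)"
proof -
  have A: "A \<in> Obj C" using cod_obj j by (auto simp: hom_def)
  have P: "internal_set C (Pi0 C A)" and c: "Eta C A \<in> hom C A (Pi0 C A)" using pi0[OF A] by auto
  have idS: "Idt C S \<in> hom C S S" using S idt_hom unfolding internal_set_def by blast
  have idP: "Idt C (Pi0 C A) \<in> hom C (Pi0 C A) (Pi0 C A)"
    using P idt_hom unfolding internal_set_def by blast
  \<comment> \<open>\<open>r\<close> extends the identity along \<open>j\<close> and plays the role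
    of a reflection map onto \<open>S\<close>; \<open>g\<close> is the map it induces on
    \<open>Pi0 C A\<close>.\<close>
  obtain r where r: "r \<in> hom C A S" "r \<cdot> j = Idt C S" using ext[OF S idS] by blast
  obtain g where g: "g \<in> hom C (Pi0 C A) S" "g \<cdot> Eta C A = r" using reflection[OF A S r(1)] by blast
  note cj = cmp_hom[OF j c]
  \<comment> \<open>The two sides agree after composition with \<open>j\<close>, and extensions
    along \<open>j\<close> to an internal set are unique.\<close>
  have "(Eta C A \<cdot> j) \<cdot> r = Eta C A"
  proof -
    have "((Eta C A \<cdot> j) \<cdot> r) \<cdot> j = Eta C A \<cdot> j"
      using cmp_assoc[OF j r(1) cj] r idt_right[OF cj] by simp
    then show ?thesis using ext[OF P cj] cmp_hom[OF r(1) cj] c by blast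
  qed
  then have "((Eta C A \<cdot> j) \<cdot> g) \<cdot> Eta C A = Idt C (Pi0 C A) \<cdot> Eta C A"
    using cmp_assoc[OF c g(1) cj] g idt_left[OF c] by simp
  then have "(Eta C A \<cdot> j) \<cdot> g = Idt C (Pi0 C A)"
    using reflection[OF A P c] cmp_hom[OF g(1) cj] idP idt_left[OF c] by (metis (no_types, lifting))
  moreover have "g \<cdot> (Eta C A \<cdot> j) = Idt C S" using cmp_assoc[OF j c g(1)] g r by simp
  ultimately show thesis using that g(1) by blast
qed

text \<open>The common part of the constructions of \<open>i\<^bsub>x,y\<^esub>\<close> and \<open>e\<^bsub>x,y\<^esub>\<close>.\<close>

lemma reflection_section:
  fixes A k p r j
  defines "s \<equiv> j \<cdot> inverse_of C (Eta C A \<cdot> j)"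
  assumes pb: "is_pullback C k p r j" and k: "k \<in> hom C (One C) B" and p: "p \<in> hom C A B"
    and S: "internal_set C (Dom C j)"
    and ext: "\<And>T u. internal_set C T \<Longrightarrow> u \<in> hom C (Dom C j) T \<Longrightarrow>
      \<exists>!d. d \<in> hom C A T \<and> d \<cdot> j = u"
  shows reflection_section_hom: "s \<in> hom C (Pi0 C A) A"
    and reflection_section_component: "a \<in> hom C (One C) (Pi0 C A) \<Longrightarrow> Eta C A \<cdot> (s \<cdot> a) = a"
    and reflection_section_over:
      "a \<in> hom C T (Pi0 C A) \<Longrightarrow> t \<in> hom C T (One C) \<Longrightarrow> p \<cdot> (s \<cdot> a) = k \<cdot> t"
    and reflection_section_eq:
      "u \<in> hom C (One C) A \<Longrightarrow> p \<cdot> u = k \<Longrightarrow> s \<cdot> (Eta C A \<cdot> u) = u"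
proof -
  have j: "j \<in> hom C (Dom C j) A" and r: "r \<in> hom C (Dom C j) (One C)" and sq: "k \<cdot> r = p \<cdot> j"
    using pb homD[OF k] homD[OF p] by (auto simp: is_pullback_def hom_def)
  have c: "Eta C A \<in> hom C A (Pi0 C A)" using pi0 dom_obj p by (auto simp: hom_def)
  note cj = cmp_hom[OF j c]
  note id1 = idt_one_hom
  obtain g where g: "g \<in> hom C (Pi0 C A) (Dom C j)" "g \<cdot> (Eta C A \<cdot> j) = Idt C (Dom C j)"
    "(Eta C A \<cdot> j) \<cdot> g = Idt C (Pi0 C A)"
    using reflection_retract[OF j S ext] by blast
  have s: "s = j \<cdot> g" unfolding s_def using inverse_of_eq[OF cj g] by simp
  show sh: "s \<in> hom C (Pi0 C A) A" using cmp_hom[OF g(1) j] s by simp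
  show "Eta C A \<cdot> (s \<cdot> a) = a" if a: "a \<in> hom C (One C) (Pi0 C A)"
    using cmp_assoc[OF a sh c] cmp_assoc[OF g(1) j c] s g idt_left[OF a] by simp
  show "p \<cdot> (s \<cdot> a) = k \<cdot> t" if a: "a \<in> hom C T (Pi0 C A)" and t: "t \<in> hom C T (One C)"
  proof -
    \<comment> \<open>The pullback square routes this composite through \<open>One C\<close>, where
      only one map is possible.\<close>
    have "p \<cdot> (s \<cdot> a) = k \<cdot> (r \<cdot> (g \<cdot> a))"
      using cmp_assoc[OF a g(1) j] cmp_assoc[OF cmp_hom[OF a g(1)] j p]
        cmp_assoc[OF cmp_hom[OF a g(1)] r k] s sq by simp
    also have "r \<cdot> (g \<cdot> a) = t"
      by (rule to_one_unique[OF cmp_hom[OF cmp_hom[OF a g(1)] r] t])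
    finally show ?thesis .
  qed
  show "s \<cdot> (Eta C A \<cdot> u) = u" if u: "u \<in> hom C (One C) A" and pu: "p \<cdot> u = k"
  proof -
    \<comment> \<open>A point \<open>u\<close> over \<open>k\<close> factors through the pullback
      \<open>j\<close>, and \<open>s \<cdot> Eta C A\<close> leaves \<open>j\<close> fixed because
      \<open>g\<close> inverts \<open>Eta C A \<cdot> j\<close>.\<close>
    have "k \<cdot> Idt C (One C) = p \<cdot> u" using pu idt_right[OF k] by simp
    then obtain h where h: "h \<in> hom C (One C) (Dom C j)" "j \<cdot> h = u"
      using pb u id1 homD[OF k] homD[OF p] unfolding is_pullback_def by metis
    have "s \<cdot> (Eta C A \<cdot> u) = j \<cdot> (g \<cdot> ((Eta C A \<cdot> j) \<cdot> h))"
      using cmp_assoc[OF h(1) j c] cmp_assoc[OF cmp_hom[OF h(1) cj] g(1) j] s h(2) by simp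
    also have "\<dots> = j \<cdot> h" using cmp_assoc[OF h(1) cj g(1)] g idt_left[OF h(1)] by simp
    finally show ?thesis using h by simp
  qed
qed

section \<open>Slices, coslices and the maps induced by left arrows\<close>

lemma slice_maps:
  assumes "y \<in> hom C (One C) X"
  shows slice_map_hom: "slice_map C y \<in> hom C (slice C y) X"
    and slice_point_hom: "slice_point C y \<in> hom C (One C) (slice C y)"
    and slice_map_point: "slice_map C y \<cdot> slice_point C y = y"
    and slice_map_Dfib: "slice_map C y \<in> Dfib C"
    and slice_point_Final: "slice_point C y \<in> Final C"
proof -
  note l = left_part[OF homD(1)[OF assms]]
  have arr: "FinalPart C y \<in> Arr C" "DfibPart C y \<in> Arr C"
    using l factorization_systemD(1,2)[OF fact_left] by blast+
  have "FinalPart C y \<in> hom C (Dom C (FinalPart C y)) (Dom C (DfibPart C y))"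
    "DfibPart C y \<in> hom C (Dom C (DfibPart C y)) (Cod C (DfibPart C y))"
    using arr l by (auto simp: hom_def)
  \<comment> \<open>The choice axioms speak only of the middle object; the outer ones are read off
    from the composite, which is \<open>y\<close>.\<close>
  from cmp_hom[OF this] have "Dom C (FinalPart C y) = One C" "Cod C (DfibPart C y) = X"
    using l homD[OF assms] by (auto simp: hom_def)
  then show "slice_map C y \<in> hom C (slice C y) X"
    "slice_point C y \<in> hom C (One C) (slice C y)"
    "slice_map C y \<cdot> slice_point C y = y" "slice_map C y \<in> Dfib C" "slice_point C y \<in> Final C"
    using l arr by (auto simp: hom_def slice_def slice_map_def slice_point_def)
qed

lemma coslice_maps:
  assumes "x \<in> hom C (One C) X"
  shows coslice_map_hom: "coslice_map C x \<in> hom C (Dom C (coslice_map C x)) X"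
    and coslice_point_hom: "coslice_point C x \<in> hom C (One C) (Dom C (coslice_map C x))"
    and coslice_map_point: "coslice_map C x \<cdot> coslice_point C x = x"
    and coslice_map_Dopf: "coslice_map C x \<in> Dopf C"
    and coslice_point_Initial: "coslice_point C x \<in> Initial C"
proof -
  note l = right_part[OF homD(1)[OF assms]]
  have arr: "InitialPart C x \<in> Arr C" "DopfPart C x \<in> Arr C"
    using l factorization_systemD(1,2)[OF fact_right] by blast+
  have "InitialPart C x \<in> hom C (Dom C (InitialPart C x)) (Dom C (DopfPart C x))"
    "DopfPart C x \<in> hom C (Dom C (DopfPart C x)) (Cod C (DopfPart C x))"
    using arr l by (auto simp: hom_def)
  from cmp_hom[OF this] have "Dom C (InitialPart C x) = One C" "Cod C (DopfPart C x) = X"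
    using l homD[OF assms] by (auto simp: hom_def)
  then show "coslice_map C x \<in> hom C (Dom C (coslice_map C x)) X"
    "coslice_point C x \<in> hom C (One C) (Dom C (coslice_map C x))"
    "coslice_map C x \<cdot> coslice_point C x = x" "coslice_map C x \<in> Dopf C"
    "coslice_point C x \<in> Initial C"
    using l arr by (auto simp: hom_def coslice_map_def coslice_point_def)
qed

text \<open>The left arrow condition is the commutativity of a square from the final map
  \<open>slice_point C x\<close> to the discrete fibration \<open>slice_map C y\<close>; its unique
  diagonal makes the description in \<open>hat\<close> proper.\<close>

lemma hat_props:
  assumes x: "x \<in> hom C (One C) X" and y: "y \<in> hom C (One C) X" and a: "left_arrow C x y a"
  shows hat_hom: "hat C x y a \<in> hom C (slice C x) (slice C y)"
    and slice_map_hat: "slice_map C y \<cdot> hat C x y a = slice_map C x"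
    and hat_slice_point: "hat C x y a \<cdot> slice_point C x = a"
proof -
  have "orthogonal C (slice_point C x) (slice_map C y)"
    by (rule factorization_systemD(3)[OF fact_left slice_point_Final[OF x] slice_map_Dfib[OF y]])
  moreover have "slice_map C y \<cdot> a = slice_map C x \<cdot> slice_point C x"
    using a slice_map_point[OF x] by (simp add: left_arrow_def)
  ultimately have "\<exists>!h. h \<in> hom C (slice C x) (slice C y) \<and>
      slice_map C y \<cdot> h = slice_map C x \<and> h \<cdot> slice_point C x = a"
    using a slice_map_hom[OF x] homD[OF slice_map_hom[OF y]] homD[OF slice_point_hom[OF x]]
    unfolding orthogonal_def left_arrow_def by (metis (no_types, lifting))
  from theI'[OF this] show "hat C x y a \<in> hom C (slice C x) (slice C y)"
    "slice_map C y \<cdot> hat C x y a = slice_map C x" "hat C x y a \<cdot> slice_point C x = a"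
    unfolding hat_def by blast+
qed

section \<open>Brackets and enriched homs\<close>

context
  fixes X x y
  assumes x: "x \<in> hom C (One C) X" and y: "y \<in> hom C (One C) X"
begin

lemma bracket_pullback:
  "is_pullback C (coslice_map C x) (slice_map C y) (bracket_p C x y) (bracket_q C x y)"
  unfolding bracket_p_def bracket_q_def
  using pb homD[OF coslice_map_hom[OF x]] homD[OF slice_map_hom[OF y]] by simp

lemma bracket_p_hom: "bracket_p C x y \<in> hom C (bracket C x y) (Dom C (coslice_map C x))"
  and bracket_q_hom: "bracket_q C x y \<in> hom C (bracket C x y) (slice C y)"
  and bracket_square: "coslice_map C x \<cdot> bracket_p C x y = slice_map C y \<cdot> bracket_q C x y"
  using bracket_pullback by (auto simp: is_pullback_def hom_def bracket_def slice_def)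

lemma bracket_universal:
  assumes "u \<in> hom C t (Dom C (coslice_map C x))" "v \<in> hom C t (slice C y)"
    "coslice_map C x \<cdot> u = slice_map C y \<cdot> v"
  shows "\<exists>!h. h \<in> hom C t (bracket C x y) \<and> bracket_p C x y \<cdot> h = u \<and> bracket_q C x y \<cdot> h = v"
  using bracket_pullback assms unfolding is_pullback_def bracket_def slice_def by blast

text \<open>The two projections are pullbacks of \<open>slice_map C y\<close> and
  \<open>coslice_map C x\<close>. Their classes are the ones along which initial maps (for
  \<open>bracket_p\<close>) and final maps (for \<open>bracket_q\<close>) are stable.\<close>

lemma bracket_p_Dfib: "bracket_p C x y \<in> Dfib C"
  by (rule right_class_stable[OF fact_left is_pullback_sym[OF bracket_pullback]
      slice_map_Dfib[OF y]])

lemma bracket_q_Dopf: "bracket_q C x y \<in> Dopf C"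
  by (rule right_class_stable[OF fact_right bracket_pullback coslice_map_Dopf[OF x]])

lemma ehom_c_hom: "ehom_c C x y \<in> hom C (bracket C x y) (ehom C x y)"
  using pi0 dom_obj homD[OF bracket_p_hom] unfolding ehom_c_def ehom_def by metis

lemma ehom_obj: "ehom C x y \<in> Obj C"
  using cod_obj homD[OF ehom_c_hom] by metis

text \<open>An instance of \<open>reflection_section\<close>: the coslice point stays initial when
  pulled back along \<open>bracket_p\<close>, and the domain of the result, a fibre of a discrete
  fibration over a point, is an internal set. By the last claim, a point over the coslice point is
  recovered from its component.\<close>

lemma
  shows ehom_i_hom: "ehom_i C x y \<in> hom C (ehom C x y) (bracket C x y)"
    and ehom_c_i: "a \<in> hom C (One C) (ehom C x y) \<Longrightarrow> ehom_c C x y \<cdot> (ehom_i C x y \<cdot> a) = a"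
    and bracket_p_i:
      "a \<in> hom C T (ehom C x y) \<Longrightarrow> t \<in> hom C T (One C) \<Longrightarrow>
        bracket_p C x y \<cdot> (ehom_i C x y \<cdot> a) = coslice_point C x \<cdot> t"
    and ehom_i_c: "u \<in> hom C (One C) (bracket C x y) \<Longrightarrow>
      bracket_p C x y \<cdot> u = coslice_point C x \<Longrightarrow> ehom_i C x y \<cdot> (ehom_c C x y \<cdot> u) = u"
proof -
  let ?k = "coslice_point C x" and ?p = "bracket_p C x y"
  note k = coslice_point_hom[OF x]
  have sq: "is_pullback C ?k ?p (Pb1 C ?k ?p) (Pb2 C ?k ?p)"
    using pb homD[OF k] homD[OF bracket_p_hom] by simp
  then have h: "Pb2 C ?k ?p \<in> hom C (Dom C (Pb2 C ?k ?p)) (bracket C x y)"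
    and "Pb1 C ?k ?p \<in> hom C (Dom C (Pb2 C ?k ?p)) (One C)"
    using homD[OF k] homD[OF bracket_p_hom] by (auto simp: is_pullback_def hom_def)
  moreover have "Pb1 C ?k ?p \<in> Dfib C"
    by (rule right_class_stable[OF fact_left is_pullback_sym[OF sq] bracket_p_Dfib])
  ultimately have S: "internal_set C (Dom C (Pb2 C ?k ?p))"
    using dom_obj unfolding internal_set_def hom_def by blast
  note ext = initial_extends[OF initial_stable[OF sq coslice_point_Initial[OF x] bracket_p_Dfib] h]
  note rs = reflection_section[OF sq k bracket_p_hom S ext]
  have i: "ehom_i C x y =
      Pb2 C ?k ?p \<cdot> inverse_of C (Eta C (bracket C x y) \<cdot> Pb2 C ?k ?p)"
    by (simp add: ehom_i_def Let_def ehom_c_def)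
  show "ehom_i C x y \<in> hom C (ehom C x y) (bracket C x y)"
    "a \<in> hom C (One C) (ehom C x y) \<Longrightarrow> ehom_c C x y \<cdot> (ehom_i C x y \<cdot> a) = a"
    "a \<in> hom C T (ehom C x y) \<Longrightarrow> t \<in> hom C T (One C) \<Longrightarrow> ?p \<cdot> (ehom_i C x y \<cdot> a) = ?k \<cdot> t"
    "u \<in> hom C (One C) (bracket C x y) \<Longrightarrow> ?p \<cdot> u = ?k \<Longrightarrow>
      ehom_i C x y \<cdot> (ehom_c C x y \<cdot> u) = u"
    unfolding i ehom_def ehom_c_def using rs by blast+
qed

text \<open>The mirror image for the fibre of \<open>bracket_q\<close> over the slice point. This
  fibre maps to \<open>One C\<close> by a discrete opfibration, so the balance axiom is what makes
  it an internal set.\<close>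

lemma
  shows ehom_e_hom: "ehom_e C x y \<in> hom C (ehom C x y) (bracket C x y)"
    and ehom_c_e: "a \<in> hom C (One C) (ehom C x y) \<Longrightarrow> ehom_c C x y \<cdot> (ehom_e C x y \<cdot> a) = a"
    and bracket_q_e:
      "a \<in> hom C T (ehom C x y) \<Longrightarrow> t \<in> hom C T (One C) \<Longrightarrow>
        bracket_q C x y \<cdot> (ehom_e C x y \<cdot> a) = slice_point C y \<cdot> t"
proof -
  let ?k = "slice_point C y" and ?q = "bracket_q C x y"
  note k = slice_point_hom[OF y]
  have sq: "is_pullback C ?k ?q (Pb1 C ?k ?q) (Pb2 C ?k ?q)"
    using pb homD[OF k] homD[OF bracket_q_hom] by simp
  then have h: "Pb2 C ?k ?q \<in> hom C (Dom C (Pb2 C ?k ?q)) (bracket C x y)"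
    and r: "Pb1 C ?k ?q \<in> hom C (Dom C (Pb2 C ?k ?q)) (One C)"
    using homD[OF k] homD[OF bracket_q_hom] by (auto simp: is_pullback_def hom_def)
  have "Pb1 C ?k ?q \<in> Dopf C"
    by (rule right_class_stable[OF fact_right is_pullback_sym[OF sq] bracket_q_Dopf])
  then have "Pb1 C ?k ?q \<in> Dfib C" using balanced[OF one r] by simp
  then have S: "internal_set C (Dom C (Pb2 C ?k ?q))"
    using dom_obj h r unfolding internal_set_def hom_def by blast
  note ext = final_extends[OF final_stable[OF sq slice_point_Final[OF y] bracket_q_Dopf] h]
  note rs = reflection_section[OF sq k bracket_q_hom S ext]
  have e: "ehom_e C x y =
      Pb2 C ?k ?q \<cdot> inverse_of C (Eta C (bracket C x y) \<cdot> Pb2 C ?k ?q)"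
    by (simp add: ehom_e_def Let_def ehom_c_def)
  show "ehom_e C x y \<in> hom C (ehom C x y) (bracket C x y)"
    "a \<in> hom C (One C) (ehom C x y) \<Longrightarrow> ehom_c C x y \<cdot> (ehom_e C x y \<cdot> a) = a"
    "a \<in> hom C T (ehom C x y) \<Longrightarrow> t \<in> hom C T (One C) \<Longrightarrow> ?q \<cdot> (ehom_e C x y \<cdot> a) = ?k \<cdot> t"
    unfolding e ehom_def ehom_c_def using rs by blast+
qed

text \<open>The image in \<open>X\<close> can be computed on the coslice side of the square, where
  \<open>ehom_i\<close> lies over the coslice point and hence over \<open>x\<close>.\<close>

lemma left_arrow_of:
  assumes a: "a \<in> hom C (One C) (ehom C x y)"
  shows "left_arrow C x y (bracket_q C x y \<cdot> ehom_i C x y \<cdot> a)"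
proof -
  note ia = cmp_hom[OF a ehom_i_hom]
  have "slice_map C y \<cdot> (bracket_q C x y \<cdot> (ehom_i C x y \<cdot> a)) =
      coslice_map C x \<cdot> (bracket_p C x y \<cdot> (ehom_i C x y \<cdot> a))"
    using cmp_assoc[OF ia bracket_q_hom slice_map_hom[OF y]] bracket_square
      cmp_assoc[OF ia bracket_p_hom coslice_map_hom[OF x]] by simp
  \<comment> \<open>For a point, the map to \<open>One C\<close> required by
    \<open>bracket_p_i\<close> is the identity.\<close>
  then show ?thesis
    using bracket_p_i[OF a idt_one_hom] idt_right[OF coslice_point_hom[OF x]]
      coslice_map_point[OF x] cmp_hom[OF ia bracket_q_hom]
    by (simp add: left_arrow_def)
qed

end

section \<open>Products and enriched composition\<close>

lemma
  assumes "a \<in> Obj C" "b \<in> Obj C"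
  shows Pr1_hom: "Pr1 C a b \<in> hom C (Prd C a b) a" and Pr2_hom: "Pr2 C a b \<in> hom C (Prd C a b) b"
  using prd[OF assms] by (auto simp: is_product_def)

lemma pairing_props:
  assumes f: "f \<in> hom C t a" and g: "g \<in> hom C t b"
  shows pairing_hom: "pairing C f g \<in> hom C t (Prd C a b)"
    and Pr1_pairing: "Pr1 C a b \<cdot> pairing C f g = f"
    and Pr2_pairing: "Pr2 C a b \<cdot> pairing C f g = g"
proof -
  have "a \<in> Obj C" "b \<in> Obj C" using f g cod_obj by (auto simp: hom_def)
  from prd[OF this] have "\<exists>!h. h \<in> hom C t (Prd C a b) \<and> Pr1 C a b \<cdot> h = f \<and> Pr2 C a b \<cdot> h = g"
    using f g unfolding is_product_def by blast
  from theI'[OF this] show "pairing C f g \<in> hom C t (Prd C a b)"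
    "Pr1 C a b \<cdot> pairing C f g = f" "Pr2 C a b \<cdot> pairing C f g = g"
    unfolding pairing_def homD[OF f] homD[OF g] by blast+
qed

context
  fixes X x y z
  assumes x: "x \<in> hom C (One C) X" and y: "y \<in> hom C (One C) X" and z: "z \<in> hom C (One C) X"
begin

text \<open>The two components are compatible because \<open>ehom_e C x y\<close> lies over the
  slice point of \<open>y\<close> and \<open>ehom_i C y z\<close> over the coslice point of
  \<open>y\<close>: in \<open>X\<close> both become the constant map at \<open>y\<close>.\<close>

lemma premult_props:
  shows premult_hom: "premult C x y z \<in> hom C (Prd C (ehom C x y) (ehom C y z)) (bracket C x z)"
    and bracket_p_premult: "bracket_p C x z \<cdot> premult C x y z =
      bracket_p C x y \<cdot> ehom_e C x y \<cdot> Pr1 C (ehom C x y) (ehom C y z)"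
    and bracket_q_premult: "bracket_q C x z \<cdot> premult C x y z =
      bracket_q C y z \<cdot> ehom_i C y z \<cdot> Pr2 C (ehom C x y) (ehom C y z)"
proof -
  let ?P = "Prd C (ehom C x y) (ehom C y z)"
  let ?r1 = "Pr1 C (ehom C x y) (ehom C y z)" and ?r2 = "Pr2 C (ehom C x y) (ehom C y z)"
  note r1 = Pr1_hom[OF ehom_obj[OF x y] ehom_obj[OF y z]]
    and r2 = Pr2_hom[OF ehom_obj[OF x y] ehom_obj[OF y z]]
  have "?P \<in> Obj C" using dom_obj homD[OF r1] by metis
  \<comment> \<open>\<open>y \<cdot> t\<close> is that constant map.\<close>
  then obtain t where t: "t \<in> hom C ?P (One C)" using one unfolding is_terminal_def by blast
  note e = cmp_hom[OF r1 ehom_e_hom[OF x y]] and i = cmp_hom[OF r2 ehom_i_hom[OF y z]]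
  have "coslice_map C x \<cdot> (bracket_p C x y \<cdot> (ehom_e C x y \<cdot> ?r1)) =
      slice_map C y \<cdot> (bracket_q C x y \<cdot> (ehom_e C x y \<cdot> ?r1))"
    using cmp_assoc[OF e bracket_p_hom[OF x y] coslice_map_hom[OF x]]
      cmp_assoc[OF e bracket_q_hom[OF x y] slice_map_hom[OF y]] bracket_square[OF x y] by simp
  also have "\<dots> = y \<cdot> t"
    using bracket_q_e[OF x y r1 t] slice_map_point[OF y]
      cmp_assoc[OF t slice_point_hom[OF y] slice_map_hom[OF y]] by simp
  also have "\<dots> = coslice_map C y \<cdot> (bracket_p C y z \<cdot> (ehom_i C y z \<cdot> ?r2))"
    using bracket_p_i[OF y z r2 t] coslice_map_point[OF y]
      cmp_assoc[OF t coslice_point_hom[OF y] coslice_map_hom[OF y]] by simp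
  also have "\<dots> = slice_map C z \<cdot> (bracket_q C y z \<cdot> (ehom_i C y z \<cdot> ?r2))"
    using cmp_assoc[OF i bracket_p_hom[OF y z] coslice_map_hom[OF y]]
      cmp_assoc[OF i bracket_q_hom[OF y z] slice_map_hom[OF z]] bracket_square[OF y z] by simp
  finally have "\<exists>!h. h \<in> hom C ?P (bracket C x z) \<and>
      bracket_p C x z \<cdot> h = bracket_p C x y \<cdot> (ehom_e C x y \<cdot> ?r1) \<and>
      bracket_q C x z \<cdot> h = bracket_q C y z \<cdot> (ehom_i C y z \<cdot> ?r2)"
    by (rule bracket_universal[OF x z cmp_hom[OF e bracket_p_hom[OF x y]]
          cmp_hom[OF i bracket_q_hom[OF y z]]])
  from theI'[OF this] show "premult C x y z \<in> hom C ?P (bracket C x z)"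
    "bracket_p C x z \<cdot> premult C x y z = bracket_p C x y \<cdot> ehom_e C x y \<cdot> ?r1"
    "bracket_q C x z \<cdot> premult C x y z = bracket_q C y z \<cdot> ehom_i C y z \<cdot> ?r2"
    unfolding premult_def by blast+
qed

lemma premult_pairing:
  assumes a: "a \<in> hom C (One C) (ehom C x y)" and b: "b \<in> hom C (One C) (ehom C y z)"
  shows "bracket_p C x z \<cdot> (premult C x y z \<cdot> pairing C a b) =
      bracket_p C x y \<cdot> (ehom_e C x y \<cdot> a)"
    and "bracket_q C x z \<cdot> (premult C x y z \<cdot> pairing C a b) =
      bracket_q C y z \<cdot> (ehom_i C y z \<cdot> b)"
proof -
  note r1 = Pr1_hom[OF ehom_obj[OF x y] ehom_obj[OF y z]]
    and r2 = Pr2_hom[OF ehom_obj[OF x y] ehom_obj[OF y z]]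
  note h = pairing_hom[OF a b]
  show "bracket_p C x z \<cdot> (premult C x y z \<cdot> pairing C a b) =
      bracket_p C x y \<cdot> (ehom_e C x y \<cdot> a)"
    using cmp_assoc[OF h premult_hom bracket_p_hom[OF x z]] bracket_p_premult Pr1_pairing[OF a b]
      cmp_assoc[OF h cmp_hom[OF r1 ehom_e_hom[OF x y]] bracket_p_hom[OF x y]]
      cmp_assoc[OF h r1 ehom_e_hom[OF x y]] by metis
  show "bracket_q C x z \<cdot> (premult C x y z \<cdot> pairing C a b) =
      bracket_q C y z \<cdot> (ehom_i C y z \<cdot> b)"
    using cmp_assoc[OF h premult_hom bracket_q_hom[OF x z]] bracket_q_premult Pr2_pairing[OF a b]
      cmp_assoc[OF h cmp_hom[OF r2 ehom_i_hom[OF y z]] bracket_q_hom[OF y z]]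
      cmp_assoc[OF h r2 ehom_i_hom[OF y z]] by metis
qed

section \<open>Comparison with composition of left arrows\<close>

lemma arrow_of_mult:
  assumes a: "a \<in> hom C (One C) (ehom C x y)" and b: "b \<in> hom C (One C) (ehom C y z)"
  shows "bracket_q C x z \<cdot> (ehom_i C x z \<cdot> (mult C x y z \<cdot> pairing C a b)) =
    hat C y z (bracket_q C y z \<cdot> (ehom_i C y z \<cdot> b)) \<cdot> (bracket_q C x y \<cdot> (ehom_i C x y \<cdot> a))"
proof -
  let ?A = "bracket C x y" and ?B = "bracket C x z"
  let ?c = "ehom_c C x y" and ?c' = "ehom_c C x z"
  let ?p = "bracket_p C x y" and ?q = "bracket_q C x y"
  let ?p' = "bracket_p C x z" and ?q' = "bracket_q C x z"
  let ?\<beta> = "bracket_q C y z \<cdot> (ehom_i C y z \<cdot> b)"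
  let ?m = "premult C x y z \<cdot> pairing C a b"
  note p = bracket_p_hom[OF x y] and q = bracket_q_hom[OF x y]
  note p' = bracket_p_hom[OF x z] and q' = bracket_q_hom[OF x z]
  note c = ehom_c_hom[OF x y] and c' = ehom_c_hom[OF x z]
  note hat = hat_props[OF y z left_arrow_of[OF y z b]]
  note ia = cmp_hom[OF a ehom_i_hom[OF x y]] and ea = cmp_hom[OF a ehom_e_hom[OF x y]]
  note m = cmp_hom[OF pairing_hom[OF a b] premult_hom]
  have "coslice_map C x \<cdot> ?p = slice_map C z \<cdot> (hat C y z ?\<beta> \<cdot> ?q)"
    using bracket_square[OF x y] cmp_assoc[OF q hat(1) slice_map_hom[OF z]] hat(2) by simp
  then obtain w where w: "w \<in> hom C ?A ?B" "?p' \<cdot> w = ?p" "?q' \<cdot> w = hat C y z ?\<beta> \<cdot> ?q"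
    using bracket_universal[OF x z p cmp_hom[OF q hat(1)]] by blast
  have A: "?A \<in> Obj C" and B: "?B \<in> Obj C"
    using dom_obj homD[OF w(1)] cod_obj by metis+
  \<comment> \<open>\<open>g\<close> is the action of the reflection on \<open>w\<close>; by
    \<open>cw\<close> it carries the component of a point to the component of its image.\<close>
  obtain g where g: "g \<in> hom C (ehom C x y) (ehom C x z)" "g \<cdot> ?c = ?c' \<cdot> w"
    using reflection[OF A _ cmp_hom[OF w(1) c']] pi0[OF B] unfolding ehom_def ehom_c_def by blast
  have pw: "?p' \<cdot> (w \<cdot> u) = ?p \<cdot> u" and qw: "?q' \<cdot> (w \<cdot> u) = hat C y z ?\<beta> \<cdot> (?q \<cdot> u)"
    and cw: "?c' \<cdot> (w \<cdot> u) = g \<cdot> (?c \<cdot> u)"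
    if u: "u \<in> hom C (One C) ?A" for u
    using cmp_assoc[OF u w(1) p'] cmp_assoc[OF u w(1) q'] cmp_assoc[OF u w(1) c']
      cmp_assoc[OF u q hat(1)] cmp_assoc[OF u c g(1)] w(2,3) g(2) by metis+
  note mp = premult_pairing[OF a b]
  have "?p' \<cdot> (w \<cdot> (ehom_e C x y \<cdot> a)) = ?p' \<cdot> ?m" using pw[OF ea] mp by simp
  \<comment> \<open>\<open>ehom_e C x y \<cdot> a\<close> projects to the slice point of
    \<open>y\<close>, which the hat sends to \<open>?\<beta>\<close>.\<close>
  moreover have "?q' \<cdot> (w \<cdot> (ehom_e C x y \<cdot> a)) = ?q' \<cdot> ?m"
    using qw[OF ea] mp bracket_q_e[OF x y a idt_one_hom] idt_right[OF slice_point_hom[OF y]] hat(3)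
    by simp
  moreover have "coslice_map C x \<cdot> (?p' \<cdot> ?m) = slice_map C z \<cdot> (?q' \<cdot> ?m)"
    using cmp_assoc[OF m p' coslice_map_hom[OF x]] cmp_assoc[OF m q' slice_map_hom[OF z]]
      bracket_square[OF x z] by simp
  ultimately have wm: "w \<cdot> (ehom_e C x y \<cdot> a) = ?m"
    using bracket_universal[OF x z cmp_hom[OF m p'] cmp_hom[OF m q']] m cmp_hom[OF ea w(1)]
    by blast
  have "mult C x y z \<cdot> pairing C a b = ?c' \<cdot> ?m"
    unfolding mult_def by (rule cmp_assoc[OF pairing_hom[OF a b] premult_hom c'])
  \<comment> \<open>Both representatives have component \<open>a\<close>, so both images under
    \<open>w\<close> have component \<open>g \<cdot> a\<close>.\<close>
  also have "\<dots> = ?c' \<cdot> (w \<cdot> (ehom_i C x y \<cdot> a))"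
    using cw[OF ea] cw[OF ia] ehom_c_e[OF x y a] ehom_c_i[OF x y a] wm by simp
  \<comment> \<open>\<open>w\<close> keeps the projection to the coslice, so the image still lies
    over the coslice point of \<open>x\<close> and \<open>ehom_i_c\<close> applies.\<close>
  finally have "ehom_i C x z \<cdot> (mult C x y z \<cdot> pairing C a b) = w \<cdot> (ehom_i C x y \<cdot> a)"
    using ehom_i_c[OF x z cmp_hom[OF ia w(1)]] pw[OF ia] bracket_p_i[OF x y a idt_one_hom]
      idt_right[OF coslice_point_hom[OF x]] by simp
  then show ?thesis using qw[OF ia] by simp
qed

end

end

theorem proposition4p11:
  fixes C :: "('o, 'm) chosen_cat" and X :: 'o and x y z \<alpha> \<beta> :: 'm
  assumes "balanced_factorization_category C"
    and "chosen_structure C"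
    and "X \<in> Obj C"
    and "x \<in> hom C (One C) X" and "y \<in> hom C (One C) X" and "z \<in> hom C (One C) X"
    and "\<alpha> \<in> hom C (One C) (ehom C x y)" and "\<beta> \<in> hom C (One C) (ehom C y z)"
  shows "arrow_of C x z (mult C x y z \<cdot>\<^bsub>C\<^esub> pairing C \<alpha> \<beta>) =
    arrow_of C y z \<beta> \<cdot>\<^bsub>underlying_category C X\<^esub> arrow_of C x y \<alpha>"
proof -
  interpret chosen_balanced_factorization_category C
    using assms(1,2) by (rule chosen_balanced_factorization_category.intro)
  show ?thesis
    \<comment> \<open>The endpoint tags agree by definition, which leaves the equality of the
      underlying points of the slice of \<open>z\<close>.\<close>
    using arrow_of_mult[OF assms(4-8)] by (simp add: arrow_of_def underlying_category_def)
qed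

end
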